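(* Let the flux $f:\mathbb{R}^m\to\mathbb{R}^m$ be smooth, with smooth entropy pair $(U,F)$, and let $a_l<a_r$ be fixed signal speed bounds. For $u_l,u_r\in\mathbb{R}^m$ let the maximal entropy dissipation prediction of the Riemann problem with left state $u_l$ and right state $u_r$ be $$\sigma^\theta(u_l,u_r)=(a_r-a_l)\,U(u_{lr})-a_rU(u_r)+a_lU(u_l)+F(u_r)-F(u_l),\qquad u_{lr}=\frac{a_r u_r-a_l u_l+f(u_l)-f(u_r)}{a_r-a_l}.$$ Then the prediction vanishes quadratically with the jump of $u$ at the interface: for fixed $u_l$, $$|\sigma^\theta(u_l,u_r)|\in\mathcal{O}\left(\|u_l-u_r\|^2\right)\quad\text{as } u_r\to u_l.$$
   Context: The underlying system is the hyperbolic system of conservation laws $\partial_tu+\partial_xf(u)=0$. An entropy pair $(U,F)$ consists of a convex function $U:\mathbb{R}^m\to\mathbb{R}$ and a function $F:\mathbb{R}^m\to\mathbb{R}$ with $\frac{\mathrm{d}U}{\mathrm{d}u}\frac{\mathrm{d}f}{\mathrm{d}u}=\frac{\mathrm{d}F}{\mathrm{d}u}$. The numbers $a_l<a_r$ are lower and upper bounds for the speeds of the signals emanating from the interface: for the Riemann problems considered (states $u_r$ near $u_l$) the solution equals $u_l$ for $x<a_lt$ and $u_r$ for $x>a_rt$. The prediction $\sigma^\theta(u_l,u_r)$ is a lower bound for the entropy dissipation rate $\int_\theta\partial_tU+\partial_xF\,\mathrm{d}x$ on an interval $\theta$ around the interface. *)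

theory Defs
  imports "HOL-Analysis.Analysis" "HOL-Library.Landau_Symbols"
begin

(* On a finite-dimensional domain a function is C^(k+1) iff it is differentiable and all its
   directional derivatives are C^k; this keeps the codomain type fixed in the recursion. *)
primrec Ck :: "nat \<Rightarrow> ('a::euclidean_space \<Rightarrow> 'b::real_normed_vector) \<Rightarrow> bool" where
  "Ck 0 g \<longleftrightarrow> continuous_on UNIV g"
| "Ck (Suc k) g \<longleftrightarrow>
     g differentiable_on UNIV \<and> (\<forall>v. Ck k (\<lambda>x. frechet_derivative g (at x) v))"

definition smooth :: "('a::euclidean_space \<Rightarrow> 'b::real_normed_vector) \<Rightarrow> bool" where
  "smooth g \<longleftrightarrow> (\<forall>k. Ck k g)"

(* The Jacobian of the flux is diagonalizable over the reals at every state. *)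
definition hyperbolic_flux :: "(real^'m \<Rightarrow> real^'m) \<Rightarrow> bool" where
  "hyperbolic_flux f \<longleftrightarrow>
     (\<forall>u. span {v. \<exists>c::real. frechet_derivative f (at u) v = c *\<^sub>R v} = UNIV)"

definition entropy_pair ::
    "(real^'m \<Rightarrow> real^'m) \<Rightarrow> (real^'m \<Rightarrow> real) \<Rightarrow> (real^'m \<Rightarrow> real) \<Rightarrow> bool" where
  "entropy_pair f U F \<longleftrightarrow>
     convex_on UNIV U \<and>
     (\<forall>u. frechet_derivative U (at u) \<circ> frechet_derivative f (at u)
            = frechet_derivative F (at u))"

definition riemann_data :: "'a \<Rightarrow> 'a \<Rightarrow> real \<Rightarrow> 'a" where
  "riemann_data ul ur x = (if x < 0 then ul else ur)"

(* Points of space-time are pairs (t, x). Test functions need not vanish at t = 0, so that the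
   weak formulations below encode the initial data. *)
definition test_function :: "(real \<times> real \<Rightarrow> real) \<Rightarrow> bool" where
  "test_function \<phi> \<longleftrightarrow> smooth \<phi> \<and> (\<exists>K. compact K \<and> (\<forall>p. p \<notin> K \<longrightarrow> \<phi> p = 0))"

abbreviation dt :: "(real \<times> real \<Rightarrow> real) \<Rightarrow> real \<times> real \<Rightarrow> real" where
  "dt \<phi> p \<equiv> frechet_derivative \<phi> (at p) (1, 0)"

abbreviation dx :: "(real \<times> real \<Rightarrow> real) \<Rightarrow> real \<times> real \<Rightarrow> real" where
  "dx \<phi> p \<equiv> frechet_derivative \<phi> (at p) (0, 1)"

(* Bounded weak solution, for t > 0, of u_t + f(u)_x = 0 with Riemann data, satisfying
   U(u)_t + F(u)_x \<le> 0 in the sense of distributions. *)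
definition riemann_solution ::
    "(real^'m \<Rightarrow> real^'m) \<Rightarrow> (real^'m \<Rightarrow> real) \<Rightarrow> (real^'m \<Rightarrow> real) \<Rightarrow>
     real^'m \<Rightarrow> real^'m \<Rightarrow> (real \<times> real \<Rightarrow> real^'m) \<Rightarrow> bool" where
  "riemann_solution f U F ul ur u \<longleftrightarrow>
     u \<in> borel_measurable lborel \<and> bounded (range u) \<and>
     (\<forall>\<phi>. test_function \<phi> \<longrightarrow>
        (LINT p:{0<..} \<times> UNIV|lborel. dt \<phi> p *\<^sub>R u p + dx \<phi> p *\<^sub>R f (u p))
        + (LINT x|lborel. \<phi> (0, x) *\<^sub>R riemann_data ul ur x) = 0) \<and>
     (\<forall>\<phi>. test_function \<phi> \<longrightarrow> (\<forall>p. \<phi> p \<ge> 0) \<longrightarrow>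
        (LINT p:{0<..} \<times> UNIV|lborel. dt \<phi> p * U (u p) + dx \<phi> p * F (u p))
        + (LINT x|lborel. \<phi> (0, x) * U (riemann_data ul ur x)) \<ge> 0)"

(* Solutions are only determined up to null sets; since u is quantified existentially, the
   pointwise conditions just select a representative. No uniqueness of the Riemann solution
   is presupposed. *)
definition signal_speed_bounds ::
    "(real^'m \<Rightarrow> real^'m) \<Rightarrow> (real^'m \<Rightarrow> real) \<Rightarrow> (real^'m \<Rightarrow> real) \<Rightarrow>
     real^'m \<Rightarrow> real \<Rightarrow> real \<Rightarrow> bool" where
  "signal_speed_bounds f U F ul al ar \<longleftrightarrow>
     (\<forall>\<^sub>F ur in nhds ul. \<exists>u. riemann_solution f U F ul ur u \<and>
        (\<forall>t>0. \<forall>x. (x < al * t \<longrightarrow> u (t, x) = ul) \<and> (x > ar * t \<longrightarrow> u (t, x) = ur)))"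

definition u_lr ::
    "(real^'m \<Rightarrow> real^'m) \<Rightarrow> real \<Rightarrow> real \<Rightarrow> real^'m \<Rightarrow> real^'m \<Rightarrow> real^'m" where
  "u_lr f al ar ul ur = (ar *\<^sub>R ur - al *\<^sub>R ul + f ul - f ur) /\<^sub>R (ar - al)"

definition dissipation_prediction ::
    "(real^'m \<Rightarrow> real^'m) \<Rightarrow> (real^'m \<Rightarrow> real) \<Rightarrow> (real^'m \<Rightarrow> real) \<Rightarrow> real \<Rightarrow> real \<Rightarrow>
     real^'m \<Rightarrow> real^'m \<Rightarrow> real" where
  "dissipation_prediction f U F al ar ul ur =
     (ar - al) * U (u_lr f al ar ul ur) - ar * U ur + al * U ul + F ur - F ul"

end

theory Submission
  imports Defs
begin

text \<open>
  Abbreviate the prediction, as a function of the right state alone, by \<open>\<sigma>\<close>. It vanishes at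
  \<open>u\<^sub>l\<close>, because the intermediate state is then \<open>u\<^sub>l\<close> itself, and its first-order part at \<open>u\<^sub>l\<close>
  vanishes as well: the derivative of the intermediate state is \<open>(a\<^sub>r - Df) / (a\<^sub>r - a\<^sub>l)\<close>, so
  that of \<open>\<sigma>\<close> is \<open>DU (a\<^sub>r - Df) - a\<^sub>r DU + DF = DF - DU Df\<close>, which is zero by the
  compatibility relation of an entropy pair. What is left is of second order.

  This cancellation is carried out on first-order Taylor remainders, which avoids
  differentiating the composition of \<open>U\<close> with the intermediate state twice. Writing
  \<open>R\<^sub>g x = g x - g u\<^sub>l - Dg (x - u\<^sub>l)\<close>, linearity of \<open>DU\<close> and compatibility give the exact identity
  \<open>\<sigma> = (a\<^sub>r - a\<^sub>l) R\<^sub>U u\<^sub>l\<^sub>r - a\<^sub>r R\<^sub>U u\<^sub>r + R\<^sub>F u\<^sub>r - DU (R\<^sub>f u\<^sub>r)\<close>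
  (\<open>dissipation_prediction_eq_remainders\<close>). Each remainder of a smooth function is quadratic
  (\<open>taylor_remainder_bigo\<close>), and the intermediate state is differentiable, so its distance from
  \<open>u\<^sub>l\<close> is at most proportional to that of \<open>u\<^sub>r\<close>.
\<close>

lemma has_derivative_increment_bigo:
  fixes g :: "'a::real_normed_vector \<Rightarrow> 'b::real_normed_vector"
  assumes "(g has_derivative g') (at y)"
  shows "(\<lambda>x. norm (g x - g y)) \<in> O[nhds y](\<lambda>x. norm (x - y))"
proof -
  have bl: "bounded_linear g'"
    using assms by (rule has_derivative_bounded_linear)
  obtain K where K: "\<And>v. norm (g' v) \<le> norm v * K"
    using bounded_linear.bounded[OF bl] by blast
  obtain d where d: "d > 0"
    "\<And>x. norm (x - y) < d \<Longrightarrow> norm (g x - g y - g' (x - y)) \<le> 1 * norm (x - y)"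
    using assms unfolding has_derivative_at_alt by (metis zero_less_one)
  have "norm (g x - g y) \<le> (1 + K) * norm (x - y)" if "dist x y < d" for x
  proof -
    have "norm (g x - g y) \<le> norm (g x - g y - g' (x - y)) + norm (g' (x - y))"
      using norm_triangle_ineq[of "g x - g y - g' (x - y)" "g' (x - y)"] by simp
    also have "\<dots> \<le> (1 + K) * norm (x - y)"
      using d(2)[of x] K[of "x - y"] that by (simp add: dist_norm algebra_simps)
    finally show ?thesis .
  qed
  then have "\<forall>\<^sub>F x in nhds y. norm (norm (g x - g y)) \<le> (1 + K) * norm (norm (x - y))"
    using d(1) unfolding eventually_nhds_metric by auto
  then show ?thesis by (rule bigoI)
qed

text \<open>
  The differential of \<open>g\<close> changes at most linearly near \<open>y\<close>, because this holds along each
  of the finitely many basis directions. By the mean value inequality the remainder, whose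
  differential is that change, then grows at most quadratically.
\<close>

lemma taylor_remainder_bigo:
  fixes g :: "'a::euclidean_space \<Rightarrow> 'b::real_normed_vector"
  assumes "Ck 2 g"
  shows "(\<lambda>x. norm (g x - g y - frechet_derivative g (at y) (x - y)))
           \<in> O[nhds y](\<lambda>x. (norm (x - y))\<^sup>2)"
proof -
  define D where "D = (\<lambda>x. frechet_derivative g (at x))"
  have g: "g differentiable at x" for x
    using assms by (simp add: numeral_2_eq_2 differentiable_on_def)
  have D: "(g has_derivative D x) (at x)" for x
    using g unfolding D_def frechet_derivative_works by simp
  have lin: "bounded_linear (D x)" for x
    using D by (rule has_derivative_bounded_linear)
  have D_diff: "(\<lambda>x. D x v) differentiable at x" for v x
    using assms by (simp add: numeral_2_eq_2 differentiable_on_def D_def)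
  have "(\<lambda>x. norm (D x b - D y b)) \<in> O[nhds y](\<lambda>x. norm (x - y))" for b
    using D_diff[of b y] has_derivative_increment_bigo unfolding differentiable_def by blast
  then have "(\<lambda>x. \<Sum>b\<in>Basis. norm (D x b - D y b)) \<in> O[nhds y](\<lambda>x. norm (x - y))"
    by (intro big_sum_in_bigo)
  then obtain C where C: "C > 0"
    "\<forall>\<^sub>F x in nhds y. norm (\<Sum>b\<in>Basis. norm (D x b - D y b)) \<le> C * norm (norm (x - y))"
    by (rule landau_o.bigE)
  then obtain d where d: "d > 0" and
    near: "\<And>x. dist x y < d \<Longrightarrow> (\<Sum>b\<in>Basis. norm (D x b - D y b)) \<le> C * norm (x - y)"
    unfolding eventually_nhds_metric by (force simp: sum_nonneg)
  have op: "norm (D x v - D y v) \<le> C * norm (x - y) * norm v" if "dist x y < d" for x v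
  proof -
    have L: "bounded_linear (\<lambda>v. D x v - D y v)"
      by (intro bounded_linear_sub lin)
    have "D x v - D y v = (\<Sum>b\<in>Basis. (v \<bullet> b) *\<^sub>R (D x b - D y b))"
      using linear_sum[OF bounded_linear.linear[OF L], of "\<lambda>b. (v \<bullet> b) *\<^sub>R b" Basis]
      by (simp add: euclidean_representation linear_cmul[OF bounded_linear.linear[OF lin]]
          scaleR_diff_right)
    also have "norm \<dots> \<le> (\<Sum>b\<in>Basis. norm v * norm (D x b - D y b))"
      by (intro sum_norm_le) (simp add: Basis_le_norm mult_right_mono)
    also have "\<dots> = (\<Sum>b\<in>Basis. norm (D x b - D y b)) * norm v"
      by (simp add: sum_distrib_left mult.commute)
    also have "\<dots> \<le> C * norm (x - y) * norm v"
      using near[OF that] by (intro mult_right_mono) auto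
    finally show ?thesis .
  qed
  have "norm (g x - g y - D y (x - y)) \<le> C * (norm (x - y))\<^sup>2" if x: "dist x y < d" for x
  proof -
    \<comment> \<open>On the ball reaching exactly to \<open>x\<close> the mean value inequality yields one factor
      \<open>norm (x - y)\<close> from the oscillation of \<open>D\<close> and the other from the increment.\<close>
    define S where "S = cball y (norm (x - y))"
    have "norm ((g x - D y x) - (g y - D y y)) \<le> (C * norm (x - y)) * norm (x - y)"
    proof (rule differentiable_bound)
      show "convex S" unfolding S_def by simp
      show "((\<lambda>z. g z - D y z) has_derivative (\<lambda>v. D z v - D y v)) (at z within S)" for z
        by (intro has_derivative_diff has_derivative_at_withinI[OF D]
            bounded_linear_imp_has_derivative lin)
      show "onorm (\<lambda>v. D z v - D y v) \<le> C * norm (x - y)" if "z \<in> S" for z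
      proof (rule onorm_bound)
        have z: "norm (z - y) \<le> norm (x - y)"
          using that by (simp add: S_def dist_norm norm_minus_commute)
        fix v
        have "norm (D z v - D y v) \<le> C * norm (z - y) * norm v"
          using x z by (intro op) (simp add: dist_norm)
        also have "\<dots> \<le> C * norm (x - y) * norm v"
          using z C(1) by (intro mult_right_mono mult_left_mono) auto
        finally show "norm (D z v - D y v) \<le> C * norm (x - y) * norm v" .
      qed (use C(1) in simp)
      show "x \<in> S" "y \<in> S" by (auto simp: S_def dist_norm norm_minus_commute)
    qed
    then show ?thesis
      by (simp add: linear_diff[OF bounded_linear.linear[OF lin]] power2_eq_square algebra_simps)
  qed
  then have "\<forall>\<^sub>F x in nhds y. norm (norm (g x - g y - D y (x - y)))
      \<le> C * norm ((norm (x - y))\<^sup>2)"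
    using d unfolding eventually_nhds_metric by auto
  then show ?thesis unfolding D_def by (rule bigoI)
qed

lemma smooth_taylor_remainder_bigo:
  assumes "smooth g"
  shows "(\<lambda>x. norm (g x - g y - frechet_derivative g (at y) (x - y)))
           \<in> O[nhds y](\<lambda>x. (norm (x - y))\<^sup>2)"
  using assms by (intro taylor_remainder_bigo) (simp add: smooth_def)

lemma smooth_has_derivative:
  assumes "smooth g"
  shows "(g has_derivative frechet_derivative g (at x)) (at x)"
proof -
  have "Ck (Suc 0) g" using assms unfolding smooth_def by blast
  then show ?thesis
    by (simp add: differentiable_on_def frechet_derivative_works)
qed

text \<open>
  All zeroth-order terms cancel because the coefficients of \<open>U\<close> add up to zero, and all terms
  linear in \<open>ur - ul\<close> cancel by compatibility. The last remainder appears because the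
  intermediate state contains \<open>f ur\<close> and not its linearization.
\<close>

lemma dissipation_prediction_eq_remainders:
  fixes f :: "real^'m \<Rightarrow> real^'m" and ul ur :: "real^'m"
  assumes "linear DU" and compat: "\<And>v. DU (Df v) = DF v" and "al < ar"
  shows "dissipation_prediction f U F al ar ul ur =
      (ar - al) * (U (u_lr f al ar ul ur) - U ul - DU (u_lr f al ar ul ur - ul))
      - ar * (U ur - U ul - DU (ur - ul))
      + (F ur - F ul - DF (ur - ul))
      - DU (f ur - f ul - Df (ur - ul))"
proof -
  let ?w = "u_lr f al ar ul ur"
  have "(ar - al) *\<^sub>R (?w - ul) = ar *\<^sub>R (ur - ul) - (f ur - f ul)"
    using assms(3) by (simp add: u_lr_def scaleR_diff_right scaleR_diff_left)
  then have "DU ((ar - al) *\<^sub>R (?w - ul)) = DU (ar *\<^sub>R (ur - ul) - (f ur - f ul))"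
    by simp
  then have "(ar - al) * DU (?w - ul) = ar * DU (ur - ul) - DU (f ur - f ul)"
    by (simp only: linear_diff[OF assms(1), of "ar *\<^sub>R (ur - ul)"] linear_cmul[OF assms(1)]
        real_scaleR_def)
  moreover have "DU (f ur - f ul - Df (ur - ul)) = DU (f ur - f ul) - DF (ur - ul)"
    by (simp only: linear_diff[OF assms(1), of "f ur - f ul"] compat)
  ultimately show ?thesis
    unfolding dissipation_prediction_def by (simp add: algebra_simps)
qed

theorem lemma3:
  fixes f :: "real^'m \<Rightarrow> real^'m"
    and U F :: "real^'m \<Rightarrow> real"
    and al ar :: real
    and ul :: "real^'m"
  assumes "smooth f" and "hyperbolic_flux f"
    and "smooth U" and "smooth F" and "entropy_pair f U F"
    and "al < ar" and "signal_speed_bounds f U F ul al ar"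
  shows "(\<lambda>ur. \<bar>dissipation_prediction f U F al ar ul ur\<bar>)
           \<in> O[nhds ul](\<lambda>ur. (norm (ul - ur))\<^sup>2)"
proof -
  define DU where "DU = frechet_derivative U (at ul)"
  define DF where "DF = frechet_derivative F (at ul)"
  define Df where "Df = frechet_derivative f (at ul)"
  let ?w = "u_lr f al ar ul"
  let ?q = "\<lambda>x. (norm (x - ul))\<^sup>2"
  have DU: "bounded_linear DU"
    using smooth_has_derivative[OF assms(3)] unfolding DU_def by (rule has_derivative_bounded_linear)
  have compat: "DU (Df v) = DF v" for v
    using assms(5) unfolding entropy_pair_def DU_def Df_def DF_def by (metis comp_apply)
  have w_ul: "?w ul = ul"
  proof -
    have "ar *\<^sub>R ul - al *\<^sub>R ul + f ul - f ul = (ar - al) *\<^sub>R ul"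
      by (simp add: scaleR_diff_left)
    then show ?thesis using assms(6) by (simp add: u_lr_def)
  qed
  have w_deriv: "(?w has_derivative (\<lambda>v. (ar *\<^sub>R v - Df v) /\<^sub>R (ar - al))) (at ul)"
    unfolding u_lr_def Df_def
    by (auto intro!: derivative_eq_intros smooth_has_derivative[OF assms(1)])
  have w_lim: "filterlim ?w (nhds ul) (nhds ul)"
    using has_derivative_continuous[OF w_deriv] tendsto_at_iff_tendsto_nhds[of ?w ul]
    by (simp add: continuous_at w_ul)
  have w_near: "(\<lambda>x. (norm (?w x - ul))\<^sup>2) \<in> O[nhds ul](?q)"
    using has_derivative_increment_bigo[OF w_deriv] unfolding w_ul by (rule landau_o.big_power)

  have RU: "(\<lambda>x. U x - U ul - DU (x - ul)) \<in> O[nhds ul](?q)"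
    using smooth_taylor_remainder_bigo[OF assms(3), of ul]
    by (simp add: DU_def)
  have RF: "(\<lambda>x. F x - F ul - DF (x - ul)) \<in> O[nhds ul](?q)"
    using smooth_taylor_remainder_bigo[OF assms(4), of ul]
    by (simp add: DF_def)
  have RUw: "(\<lambda>x. U (?w x) - U ul - DU (?w x - ul)) \<in> O[nhds ul](?q)"
    using landau_o.big.compose[OF RU w_lim] w_near by (rule landau_o.big_trans)
  have Rf: "(\<lambda>x. DU (f x - f ul - Df (x - ul))) \<in> O[nhds ul](?q)"
  proof -
    obtain K where "\<And>v. norm (DU v) \<le> norm v * K"
      using bounded_linear.bounded[OF DU] by blast
    then have "(\<lambda>x. DU (f x - f ul - Df (x - ul)))
        \<in> O[nhds ul](\<lambda>x. norm (f x - f ul - Df (x - ul)))"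
      by (intro bigoI[where c = K] always_eventually) (simp add: mult.commute)
    also have "(\<lambda>x. norm (f x - f ul - Df (x - ul))) \<in> O[nhds ul](?q)"
      using smooth_taylor_remainder_bigo[OF assms(1), of ul] by (simp add: Df_def)
    finally show ?thesis .
  qed
  have "dissipation_prediction f U F al ar ul = (\<lambda>x.
      (ar - al) * (U (?w x) - U ul - DU (?w x - ul))
      - ar * (U x - U ul - DU (x - ul)) + (F x - F ul - DF (x - ul))
      - DU (f x - f ul - Df (x - ul)))"
    by (rule ext)
      (rule dissipation_prediction_eq_remainders[OF bounded_linear.linear[OF DU] compat assms(6)])
  also have "\<dots> \<in> O[nhds ul](?q)"
    by (intro sum_in_bigo RF Rf cmult_in_bigo_iff[THEN iffD2] disjI2 RU RUw)
  finally have "dissipation_prediction f U F al ar ul \<in> O[nhds ul](?q)" .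
  then show ?thesis by (simp add: norm_minus_commute)
qed

end
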